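(* Suppose that (i) $g$ and $\Phi$ are continuous, and (ii) for any $(H,h)\in\mathcal{H}\times\mathbb{R}^e$ with $h\ne0$ there exists $s\in\Omega$ such that $(H\cdot S)_T+hg<0$ along the path $s$. Let $c^n\in\mathbb{R}^e$ with $|c^n|\to0$. Then $$\lim_{n\to\infty}\underline\pi^n(\Phi)=\underline\pi(\Phi).$$ Furthermore, if $\Phi$ and $g$ are Lipschitz continuous and $|c^n|=O(1/2^n)$, then $$|\underline\pi^n(\Phi)-\underline\pi(\Phi)|=O(1/2^n).$$
   Context: $T,e\in\mathbb{N}$. $\Omega=\{1\}\times[a_1,b_1]\times\cdots\times[a_T,b_T]$ with $0\le a_T<\cdots<a_1<1<b_1<\cdots<b_T<\infty$ and all $a_i,b_i\in\mathbb{D}:=\bigcup_n\{0,1/2^n,2/2^n,\dots\}$. $\Omega^n:=\Omega\cap\{0,1/2^n,2/2^n,\dots\}^{T+1}$; only $n$ large enough that $a_i,b_i\in\{0,1/2^n,2/2^n,\dots\}$ for all $i$ are considered. $S=(S_0,\dots,S_T)$ is the canonical process $S_i(s_0,\dots,s_T)=s_i$. $|\cdot|$ denotes the sup norm. $\mathcal{H}$ is the set of trading strategies $H=(H_i)_{i=0}^{T-1}$, $H_i$ a real function on $\prod_{j=1}^i[a_j,b_j]$ (evaluated at $(s_1,\dots,s_i)$; $H_0$ a constant). $\mathcal{H}^n$ is the set of $H=(H_i)_{i=0}^{T-1}$ with $H_i$ a real function on $\prod_{j=1}^i\big([a_j,b_j]\cap\{0,1/2^n,2/2^n,\dots\}\big)$.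 $(H\cdot S)_T=\sum_{i=0}^{T-1}H_i(s_1,\dots,s_i)(s_{i+1}-s_i)$. $\mathcal{T}$ (resp. $\mathcal{T}^n$) is the set of stopping times $\tau:\Omega\to\{0,\dots,T\}$ (resp. $\tau:\Omega^n\to\{0,\dots,T\}$), meaning: if $\tau(s^1)=k$ and $s^1_i=s^2_i$ for $i=0,\dots,k$, then $\tau(s^2)=k$. $g=(g_1,\dots,g_e):\Omega\to\mathbb{R}^e$ are the payoffs of options traded statically at time $0$ at price $0$ in the original market and at prices $c^n=(c^n_1,\dots,c^n_e)$ in the $n$-th discretized market; $hg$ is the inner product. $\Phi:\{0,\dots,T\}\times\Omega\to\mathbb{R}$ is the payoff of the American option, adapted ($\Phi_t(s)$ depends only on $(s_0,\dots,s_t)$); $\Phi_\tau(s)=\Phi_{\tau(s)}(s)$. Continuity (Lipschitz continuity) of $\Phi$ means that of each $\Phi_t$ in $s$. The sub-hedging prices are $$\underline\pi(\Phi):=\sup\{x\in\mathbb{R}:\exists(H,\tau,h)\in\mathcal{H}\times\mathcal{T}\times\mathbb{R}^e\text{ s.t. }\Phi_\tau+(H\cdot S)_T+hg\ge x\ \ \forall s\in\Omega\},$$ $$\underline\pi^n(\Phi):=\sup\{x\in\mathbb{R}:\exists(H,\tau,h)\in\mathcal{H}^n\times\mathcal{T}^n\times\mathbb{R}^e\text{ s.t. }\Phi_\tau+(H\cdot S)_T+h(g-c^n)\ge x\ \ \forall s\in\Omega^n\}.$$ *)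

theory Defs
  imports "HOL-Analysis.Analysis" "HOL-Library.Landau_Symbols"
begin

text \<open>
  A price path \<open>(s\<^sub>0, \<dots>, s\<^sub>T)\<close> is a function on \<open>nat\<close>, extensional on \<open>{0..T}\<close>.
  A market is given by the horizon \<open>T\<close> and the sets \<open>D i\<close> of possible prices at time \<open>i\<close>;
  the original and the discretized markets are obtained from different choices of \<open>D\<close>.
\<close>

type_synonym path = "nat \<Rightarrow> real"

definition grid :: "nat \<Rightarrow> real set" where
  "grid n = {real k / 2 ^ n | k. True}"

definition prices :: "(nat \<Rightarrow> real) \<Rightarrow> (nat \<Rightarrow> real) \<Rightarrow> nat \<Rightarrow> real set" where
  "prices a b i = (if i = 0 then {1} else {a i..b i})"

definition grid_prices :: "(nat \<Rightarrow> real) \<Rightarrow> (nat \<Rightarrow> real) \<Rightarrow> nat \<Rightarrow> nat \<Rightarrow> real set" where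
  "grid_prices a b n i = prices a b i \<inter> grid n"

definition paths :: "nat \<Rightarrow> (nat \<Rightarrow> real set) \<Rightarrow> path set" where
  "paths T D = (\<Pi>\<^sub>E i\<in>{0..T}. D i)"

text \<open>
  \<open>H i\<close> is a function on the product of \<open>D 1, \<dots>, D i\<close>. Its argument is the path restricted to
  \<open>{1..i}\<close>, so that \<open>H 0\<close> amounts to a constant.
\<close>

definition strategies :: "nat \<Rightarrow> (nat \<Rightarrow> real set) \<Rightarrow> (nat \<Rightarrow> path \<Rightarrow> real) set" where
  "strategies T D = (\<Pi>\<^sub>E i\<in>{0..<T}. extensional (\<Pi>\<^sub>E j\<in>{1..i}. D j))"

definition gains :: "nat \<Rightarrow> (nat \<Rightarrow> path \<Rightarrow> real) \<Rightarrow> path \<Rightarrow> real" where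
  "gains T H s = (\<Sum>i\<in>{0..<T}. H i (restrict s {1..i}) * (s (i + 1) - s i))"

definition stopping_times :: "nat \<Rightarrow> (nat \<Rightarrow> real set) \<Rightarrow> (path \<Rightarrow> nat) set" where
  "stopping_times T D =
     {\<tau> \<in> paths T D \<rightarrow>\<^sub>E {0..T}.
        \<forall>s1\<in>paths T D. \<forall>s2\<in>paths T D. \<forall>k.
          \<tau> s1 = k \<and> (\<forall>i\<in>{0..k}. s1 i = s2 i) \<longrightarrow> \<tau> s2 = k}"

definition adapted :: "nat \<Rightarrow> (nat \<Rightarrow> real set) \<Rightarrow> (nat \<Rightarrow> path \<Rightarrow> real) \<Rightarrow> bool" where
  "adapted T D \<Phi> \<longleftrightarrow>
     (\<forall>t\<in>{0..T}. \<forall>s1\<in>paths T D. \<forall>s2\<in>paths T D.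
        (\<forall>i\<in>{0..t}. s1 i = s2 i) \<longrightarrow> \<Phi> t s1 = \<Phi> t s2)"

text \<open>
  \<open>f\<close> is the payoff of the static options net of their prices at time 0. The supremum is taken
  in the extended reals, so that it makes sense for every \<open>f\<close>.
\<close>

definition sub_hedging_price ::
  "nat \<Rightarrow> (nat \<Rightarrow> real set) \<Rightarrow> (path \<Rightarrow> real ^ 'e) \<Rightarrow> (nat \<Rightarrow> path \<Rightarrow> real) \<Rightarrow> ereal" where
  "sub_hedging_price T D f \<Phi> =
     Sup {ereal x | x.
       \<exists>H\<in>strategies T D. \<exists>\<tau>\<in>stopping_times T D. \<exists>h.
         \<forall>s\<in>paths T D. \<Phi> (\<tau> s) s + gains T H s + h \<bullet> f s \<ge> x}"

text \<open>
  Lipschitz continuity is with respect to the sup norms; the metric of the type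
  \<open>nat \<Rightarrow> real\<close> is a different one, although it induces the same topology on \<open>paths T D\<close>.
\<close>

definition path_dist :: "nat \<Rightarrow> path \<Rightarrow> path \<Rightarrow> real" where
  "path_dist T s1 s2 = (MAX i\<in>{0..T}. \<bar>s1 i - s2 i\<bar>)"

definition lipschitz_paths ::
  "nat \<Rightarrow> (nat \<Rightarrow> real set) \<Rightarrow> (path \<Rightarrow> 'a::euclidean_space) \<Rightarrow> bool" where
  "lipschitz_paths T D f \<longleftrightarrow>
     (\<exists>L. \<forall>s1\<in>paths T D. \<forall>s2\<in>paths T D. infnorm (f s1 - f s2) \<le> L * path_dist T s1 s2)"

end

theory Submission
  imports Defs
begin

text \<open>
  At every time the price can still move up and down by at least \<open>\<eta>\<close>, so a strategy whose final loss
  never exceeds \<open>K\<close> has all its positions bounded by a constant times \<open>K\<close>. Hence strategies that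
  matter lie in a compact product of intervals, and Tychonoff's theorem upgrades the absence of
  arbitrage to \<open>inf\<^sub>s ((H \<cdot> S)\<^sub>T + h g) \<le> - \<delta> \<bar>h\<bar>\<close>, which bounds the static positions \<open>h\<close>.

  A strategy on the grid is lifted to the original market by rounding all prices down to the grid;
  since its positions are bounded, this changes the gains by \<open>O(1/2\<^sup>n)\<close> only. So the bound on \<open>h\<close>
  carries over to the grid markets, and restricting and lifting compare the two prices up to the
  oscillation of \<open>g\<close> and \<open>\<Phi>\<close> at scale \<open>1/2\<^sup>n\<close>, the size of \<open>c\<^sup>n\<close>, and \<open>1/2\<^sup>n\<close>.
\<close>

subsection \<open>Strategies with losses bounded from below\<close>

lemma gains_Suc:
  "gains (Suc i) H s = gains i H s + H i (restrict s {1..i}) * (s (Suc i) - s i)"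
  by (simp add: gains_def)

lemma gains_cong:
  assumes "\<And>j. j \<le> i \<Longrightarrow> s j = s' j"
  shows "gains i H s = gains i H s'"
proof -
  have "restrict s {1..k} = restrict s' {1..k}" if "k < i" for k
    using assms that by (intro restrict_ext) auto
  then show ?thesis
    using assms by (auto simp: gains_def intro!: sum.cong)
qed

lemma gains_scale: "gains T (\<lambda>i p. r * H i p) s = r * gains T H s"
  by (simp add: gains_def sum_distrib_left mult.assoc)

lemma path_mem: "s \<in> paths T D \<Longrightarrow> i \<le> T \<Longrightarrow> s i \<in> D i"
  by (auto simp: paths_def)

lemma paths_mono: "(\<And>i. i \<le> T \<Longrightarrow> D i \<subseteq> D' i) \<Longrightarrow> paths T D \<subseteq> paths T D'"
  unfolding paths_def by (rule PiE_mono) auto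

text \<open>All that the bound on positions needs to know about the price sets: the price may stay
  where it is, may move by at least \<eta> in either direction, and never moves by more than R. The
  original market and the grid markets satisfy this with the same \<eta> and R, so every constant
  derived from them is uniform in n.\<close>

definition widening :: "nat \<Rightarrow> (nat \<Rightarrow> real set) \<Rightarrow> real \<Rightarrow> real \<Rightarrow> bool" where
  "widening T D \<eta> R \<longleftrightarrow> 0 < \<eta> \<and> 0 \<le> R \<and> 1 \<in> D 0 \<and>
     (\<forall>i<T. \<forall>x\<in>D i. x \<in> D (Suc i) \<and> (\<exists>l\<in>D (Suc i). l + \<eta> \<le> x) \<and>
        (\<exists>u\<in>D (Suc i). x + \<eta> \<le> u) \<and> (\<forall>y\<in>D (Suc i). \<bar>y - x\<bar> \<le> R))"

lemma wideningD:
  assumes "widening T D \<eta> R"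
  shows "0 < \<eta>" "0 \<le> R" "1 \<in> D 0"
    and "i < T \<Longrightarrow> x \<in> D i \<Longrightarrow> x \<in> D (Suc i)"
    and "i < T \<Longrightarrow> x \<in> D i \<Longrightarrow> \<exists>l\<in>D (Suc i). l + \<eta> \<le> x"
    and "i < T \<Longrightarrow> x \<in> D i \<Longrightarrow> \<exists>u\<in>D (Suc i). x + \<eta> \<le> u"
    and "i < T \<Longrightarrow> x \<in> D i \<Longrightarrow> y \<in> D (Suc i) \<Longrightarrow> \<bar>y - x\<bar> \<le> R"
  using assms unfolding widening_def by blast+

lemma widening_mem_mono:
  assumes "widening T D \<eta> R" "x \<in> D i" "i \<le> j" "j \<le> T"
  shows "x \<in> D j"
  using assms(3,4)
proof (induction j rule: dec_induct)
  case base
  show ?case by (rule assms(2))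
next
  case (step k)
  then show ?case using wideningD(4)[OF assms(1), of k x] by simp
qed

lemma widening_one: "widening T D \<eta> R \<Longrightarrow> i \<le> T \<Longrightarrow> 1 \<in> D i"
  using widening_mem_mono[of T D \<eta> R 1 0 i] wideningD(3) by blast

text \<open>The test path on which no strategy gains anything. It shows that path sets are nonempty
  and that bounds for losses are nonnegative.\<close>

definition constant_path :: "nat \<Rightarrow> path" where
  "constant_path T = (\<lambda>i\<in>{0..T}. 1)"

lemma constant_path_in_paths: "widening T D \<eta> R \<Longrightarrow> constant_path T \<in> paths T D"
  by (auto simp: constant_path_def paths_def widening_one)

lemma gains_constant_path: "gains T H (constant_path T) = 0"
  by (simp add: gains_def constant_path_def)

lemma gains_ge_before_jump:
  assumes D: "widening T D \<eta> R"
    and low: "\<And>s. s \<in> paths T D \<Longrightarrow> - K \<le> gains T H s"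
    and s: "s \<in> paths T D" and i: "i < T" and v: "v \<in> D (Suc i)"
  shows "- K \<le> gains i H s + H i (restrict s {1..i}) * (v - s i)"
proof -
  \<comment> \<open>Once the price has jumped to \<open>v\<close> it may stay there, and no more gains are made.\<close>
  define p where "p = (\<lambda>j\<in>{0..T}. if j \<le> i then s j else v)"
  have p: "p \<in> paths T D"
    unfolding p_def paths_def
  proof (rule restrict_PiE_iff[THEN iffD2], intro ballI)
    fix j assume "j \<in> {0..T}"
    then show "(if j \<le> i then s j else v) \<in> D j"
      using path_mem[OF s] widening_mem_mono[OF D v] by auto
  qed
  have "gains k H p = gains (Suc i) H p" if "Suc i \<le> k" "k \<le> T" for k
    using that by (induction k rule: dec_induct) (simp_all add: gains_Suc p_def)
  from this[of T] have "gains T H p = gains (Suc i) H p"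
    using i by simp
  moreover have "gains i H p = gains i H s"
    by (rule gains_cong) (use i in \<open>simp add: p_def\<close>)
  moreover have "restrict p {1..i} = restrict s {1..i}"
    by (rule restrict_ext) (use i in \<open>simp add: p_def\<close>)
  moreover have "p (Suc i) = v" "p i = s i"
    using i by (auto simp: p_def)
  ultimately show ?thesis
    using low[OF p] by (simp add: gains_Suc)
qed

text \<open>A jump of at least \<eta> against the current position may not push the total below -K,
  so the position times \<eta> is at most K plus the gains so far. One step adds at most the
  position times R, so this reserve grows by a factor of at most 1 + R / \<eta> per step.\<close>

lemma strategy_bounded:
  assumes D: "widening T D \<eta> R"
    and low: "\<And>s. s \<in> paths T D \<Longrightarrow> - K \<le> gains T H s"
    and s: "s \<in> paths T D" and i: "i < T"
  shows "\<bar>H i (restrict s {1..i})\<bar> \<le> (1 + R / \<eta>) ^ T / \<eta> * K"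
proof -
  have \<eta>: "0 < \<eta>" and R: "0 \<le> R"
    using wideningD(1,2)[OF D] by auto
  have K: "0 \<le> K"
    using low[OF constant_path_in_paths[OF D]] by (simp add: gains_constant_path)
  \<comment> \<open>The jump to \<open>l\<close> hurts a nonnegative position, the jump to
    \<open>u\<close> a negative one.\<close>
  have step: "\<bar>H k (restrict s {1..k})\<bar> * \<eta> \<le> K + gains k H s" if k: "k < T" for k
  proof -
    let ?h = "H k (restrict s {1..k})"
    obtain l u where l: "l \<in> D (Suc k)" "l + \<eta> \<le> s k" and u: "u \<in> D (Suc k)" "s k + \<eta> \<le> u"
      using wideningD(5,6)[OF D k path_mem[OF s]] k by fastforce
    have 1: "- K \<le> gains k H s + ?h * (l - s k)"
      and 2: "- K \<le> gains k H s + ?h * (u - s k)"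
      using gains_ge_before_jump[OF D low s k] l u by auto
    show ?thesis
    proof (cases "0 \<le> ?h")
      case True
      then have "?h * \<eta> \<le> ?h * (s k - l)"
        using l by (intro mult_left_mono) auto
      with 1 True show ?thesis by (simp add: algebra_simps)
    next
      case False
      then have "- ?h * \<eta> \<le> - ?h * (u - s k)"
        using u by (intro mult_left_mono) auto
      with 2 False show ?thesis by (simp add: algebra_simps)
    qed
  qed
  \<comment> \<open>A discrete Gronwall argument: \<open>step\<close> bounds the position in the
    next increment by the reserve itself.\<close>
  have grow: "K + gains k H s \<le> K * (1 + R / \<eta>) ^ k" if "k \<le> T" for k
    using that
  proof (induction k)
    case 0
    then show ?case by (simp add: gains_def)
  next
    case (Suc k)
    let ?h = "H k (restrict s {1..k})"
    have "\<bar>s (Suc k) - s k\<bar> \<le> R"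
      using wideningD(7)[OF D, of k] Suc.prems path_mem[OF s, of k] path_mem[OF s, of "Suc k"] by simp
    then have "\<bar>?h * (s (Suc k) - s k)\<bar> \<le> \<bar>?h\<bar> * R"
      by (simp add: abs_mult mult_left_mono)
    also have "\<dots> = \<bar>?h\<bar> * \<eta> * (R / \<eta>)"
      using \<eta> by simp
    also have "\<dots> \<le> (K + gains k H s) * (R / \<eta>)"
      using step[of k] Suc.prems \<eta> R by (intro mult_right_mono) auto
    finally have "K + gains (Suc k) H s \<le> (K + gains k H s) * (1 + R / \<eta>)"
      by (simp add: gains_Suc distrib_left)
    also have "\<dots> \<le> K * (1 + R / \<eta>) ^ k * (1 + R / \<eta>)"
      using Suc \<eta> R by (intro mult_right_mono) auto
    finally show ?case by (simp add: mult_ac)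
  qed
  have "\<bar>H i (restrict s {1..i})\<bar> * \<eta> \<le> K * (1 + R / \<eta>) ^ i"
    using step[OF i] grow[of i] i by linarith
  also have "\<dots> \<le> K * (1 + R / \<eta>) ^ T"
    using i K \<eta> R by (intro mult_left_mono power_increasing) auto
  finally show ?thesis
    using \<eta> by (simp add: field_simps)
qed

subsection \<open>Subhedging by arbitrary families of functions\<close>

text \<open>Here \<open>H\<close> and \<open>\<tau>\<close> are arbitrary total functions, without
  the extensionality built into \<open>strategies\<close> and \<open>stopping_times\<close>. A hedge
  can then be restricted to the grid or lifted from it without adjusting domains.\<close>

definition subhedges ::
  "nat \<Rightarrow> (nat \<Rightarrow> real set) \<Rightarrow> (path \<Rightarrow> 'a::euclidean_space) \<Rightarrow> (nat \<Rightarrow> path \<Rightarrow> real) \<Rightarrow>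
   (nat \<Rightarrow> path \<Rightarrow> real) \<Rightarrow> (path \<Rightarrow> nat) \<Rightarrow> 'a \<Rightarrow> real \<Rightarrow> bool" where
  "subhedges T D f \<Phi> H \<tau> h x \<longleftrightarrow>
     (\<forall>s\<in>paths T D. \<Phi> (\<tau> s) s + gains T H s + h \<bullet> f s \<ge> x)"

definition stops :: "nat \<Rightarrow> (nat \<Rightarrow> real set) \<Rightarrow> (path \<Rightarrow> nat) \<Rightarrow> bool" where
  "stops T D \<tau> \<longleftrightarrow> (\<forall>s\<in>paths T D. \<tau> s \<le> T) \<and>
     (\<forall>s1\<in>paths T D. \<forall>s2\<in>paths T D. \<forall>k.
        \<tau> s1 = k \<and> (\<forall>i\<in>{0..k}. s1 i = s2 i) \<longrightarrow> \<tau> s2 = k)"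

lemma stops_le: "stops T D \<tau> \<Longrightarrow> s \<in> paths T D \<Longrightarrow> \<tau> s \<le> T"
  unfolding stops_def by blast

lemma subhedgesD:
  "subhedges T D f \<Phi> H \<tau> h x \<Longrightarrow> s \<in> paths T D \<Longrightarrow> x \<le> \<Phi> (\<tau> s) s + gains T H s + h \<bullet> f s"
  unfolding subhedges_def by blast

definition strategy_of ::
  "nat \<Rightarrow> (nat \<Rightarrow> real set) \<Rightarrow> (nat \<Rightarrow> path \<Rightarrow> real) \<Rightarrow> nat \<Rightarrow> path \<Rightarrow> real" where
  "strategy_of T D H = (\<lambda>i\<in>{0..<T}. restrict (H i) (\<Pi>\<^sub>E j\<in>{1..i}. D j))"

lemma strategy_of_in_strategies: "strategy_of T D H \<in> strategies T D"
  by (auto simp: strategy_of_def strategies_def)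

lemma gains_strategy_of:
  assumes "s \<in> paths T D"
  shows "gains T (strategy_of T D H) s = gains T H s"
  unfolding gains_def
proof (rule sum.cong)
  fix i assume i: "i \<in> {0..<T}"
  then have "restrict s {1..i} \<in> (\<Pi>\<^sub>E j\<in>{1..i}. D j)"
    using path_mem[OF assms] by (auto simp: restrict_PiE_iff)
  with i show "strategy_of T D H i (restrict s {1..i}) * (s (i + 1) - s i) =
      H i (restrict s {1..i}) * (s (i + 1) - s i)"
    by (simp add: strategy_of_def)
qed simp

lemma stops_restrict:
  assumes "stops T D \<tau>"
  shows "restrict \<tau> (paths T D) \<in> stopping_times T D"
proof -
  let ?\<tau> = "restrict \<tau> (paths T D)"
  have "?\<tau> \<in> paths T D \<rightarrow>\<^sub>E {0..T}"
    using assms[unfolded stops_def, THEN conjunct1] by (simp add: restrict_PiE_iff)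
  moreover have "?\<tau> s2 = k"
    if "s1 \<in> paths T D" "s2 \<in> paths T D" "?\<tau> s1 = k \<and> (\<forall>i\<in>{0..k}. s1 i = s2 i)" for s1 s2 k
  proof -
    have "\<tau> s1 = k" using that(1,3) by simp
    then have "\<tau> s2 = k"
      using assms[unfolded stops_def, THEN conjunct2, rule_format, OF that(1,2), of k] that(3)
      by simp
    then show ?thesis using that(2) by simp
  qed
  ultimately show ?thesis
    unfolding stopping_times_def by (intro CollectI conjI ballI allI impI)
qed

lemma stopping_time_stops:
  assumes "\<tau> \<in> stopping_times T D"
  shows "stops T D \<tau>"
proof -
  have "\<tau> \<in> paths T D \<rightarrow>\<^sub>E {0..T}"
    using assms[unfolded stopping_times_def mem_Collect_eq] by (rule conjunct1)
  then have "\<forall>s\<in>paths T D. \<tau> s \<le> T"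
    by (simp add: PiE_iff)
  moreover have "\<forall>s1\<in>paths T D. \<forall>s2\<in>paths T D. \<forall>k.
      \<tau> s1 = k \<and> (\<forall>i\<in>{0..k}. s1 i = s2 i) \<longrightarrow> \<tau> s2 = k"
    using assms[unfolded stopping_times_def mem_Collect_eq] by (rule conjunct2)
  ultimately show ?thesis
    unfolding stops_def by (rule conjI)
qed

lemma stops_subset:
  "stops T D \<tau> \<Longrightarrow> paths T D' \<subseteq> paths T D \<Longrightarrow> stops T D' \<tau>"
  unfolding stops_def by blast

text \<open>Gains and payoffs only read \<open>H\<close> and \<open>\<tau>\<close> at arguments that
  come from admissible paths. Truncating both to their proper domains therefore changes
  nothing.\<close>

lemma sub_hedging_price_eq:
  "sub_hedging_price T D f \<Phi> =
     Sup (ereal ` {x. \<exists>H \<tau> h. stops T D \<tau> \<and> subhedges T D f \<Phi> H \<tau> h x})"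
proof -
  have "(\<exists>H\<in>strategies T D. \<exists>\<tau>\<in>stopping_times T D. \<exists>h.
           \<forall>s\<in>paths T D. \<Phi> (\<tau> s) s + gains T H s + h \<bullet> f s \<ge> x) \<longleftrightarrow>
        (\<exists>H \<tau> h. stops T D \<tau> \<and> subhedges T D f \<Phi> H \<tau> h x)" (is "?L \<longleftrightarrow> ?R") for x
  proof
    assume ?L
    then show ?R
      using stopping_time_stops unfolding subhedges_def by blast
  next
    assume ?R
    then obtain H \<tau> h where *: "stops T D \<tau>" "subhedges T D f \<Phi> H \<tau> h x" by auto
    then have "\<forall>s\<in>paths T D. \<Phi> (restrict \<tau> (paths T D) s) s + gains T (strategy_of T D H) s
        + h \<bullet> f s \<ge> x"
      by (auto simp: subhedges_def gains_strategy_of)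
    then show ?L
      using strategy_of_in_strategies stops_restrict[OF *(1)] by blast
  qed
  then show ?thesis
    unfolding sub_hedging_price_def by (simp add: setcompr_eq_image)
qed

text \<open>Elements below the common element m are dominated by m in either set, so the transfer up
  to E is only needed from m on. For the prices, m is the value of not trading; hedges of at least
  this value have bounded positions.\<close>

lemma real_Sup_close:
  fixes A B :: "real set"
  assumes A: "m \<in> A" "\<And>x. x \<in> A \<Longrightarrow> x \<le> M" and B: "m \<in> B" "\<And>x. x \<in> B \<Longrightarrow> x \<le> M"
    and E: "0 \<le> E" and AB: "\<And>x. x \<in> A \<Longrightarrow> m \<le> x \<Longrightarrow> x - E \<in> B"
    and BA: "\<And>x. x \<in> B \<Longrightarrow> m \<le> x \<Longrightarrow> x - E \<in> A"
  shows "\<bar>Sup A - Sup B\<bar> \<le> E"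
proof -
  have *: "Sup A \<le> Sup B + E"
    if "m \<in> A" "m \<in> B" "\<And>x. x \<in> B \<Longrightarrow> x \<le> M" "\<And>x. x \<in> A \<Longrightarrow> m \<le> x \<Longrightarrow> x - E \<in> B"
    for A B :: "real set"
  proof (rule cSup_least)
    show "A \<noteq> {}" using that(1) by auto
    have bdd: "bdd_above B" using that(3) by (rule bdd_aboveI)
    fix x assume x: "x \<in> A"
    show "x \<le> Sup B + E"
    proof (cases "m \<le> x")
      case True
      then show ?thesis using cSup_upper[OF that(4)[OF x] bdd] by simp
    next
      case False
      then show ?thesis using cSup_upper[OF that(2) bdd] E by simp
    qed
  qed
  show ?thesis
    using *[of A B] *[of B A] assms by fastforce
qed

lemma ereal_Sup_bounded:
  fixes A :: "real set"
  assumes "m \<in> A" "\<And>x. x \<in> A \<Longrightarrow> x \<le> M"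
  shows "Sup (ereal ` A) = ereal (Sup A)"
proof -
  have "ereal m \<le> Sup (ereal ` A)" "Sup (ereal ` A) \<le> ereal M"
    using assms by (auto intro: Sup_upper Sup_least)
  then have "\<bar>Sup (ereal ` A)\<bar> \<noteq> \<infinity>"
    by (cases "Sup (ereal ` A)") auto
  then show ?thesis
    by (simp add: ereal_Sup)
qed

subsection \<open>Robust absence of arbitrage\<close>

text \<open>Tychonoff's theorem, applied once over all arguments \<open>p\<close> and once over all
  times \<open>i\<close>. The topology on the function types is that of pointwise
  convergence.\<close>

lemma compact_bounded_strategies:
  "compact {H :: nat \<Rightarrow> path \<Rightarrow> real. \<forall>i p. H i p \<in> {- C..C}}"
proof -
  have 1: "compact ((\<Pi>\<^sub>E p\<in>UNIV. {- C..C}) :: (path \<Rightarrow> real) set)"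
    using compactin_PiE[of "\<lambda>_::path. euclidean :: real topology" UNIV "\<lambda>_. {- C..C}"]
    by (simp add: euclidean_product_topology)
  have "compact ((\<Pi>\<^sub>E i\<in>UNIV. \<Pi>\<^sub>E p\<in>UNIV. {- C..C}) :: (nat \<Rightarrow> path \<Rightarrow> real) set)"
    using compactin_PiE[of "\<lambda>_::nat. euclidean :: (path \<Rightarrow> real) topology" UNIV
        "\<lambda>_. \<Pi>\<^sub>E p\<in>UNIV. {- C..C}"] 1
    by (simp add: euclidean_product_topology)
  then show ?thesis
    by (simp add: PiE_UNIV_domain Pi_def)
qed

text \<open>For a fixed path only finitely many values of the strategy occur, so pointwise
  convergence of strategies is enough.\<close>

lemma continuous_on_gains:
  "continuous_on UNIV (\<lambda>q :: (nat \<Rightarrow> path \<Rightarrow> real) \<times> 'a::euclidean_space. gains T (fst q) s + snd q \<bullet> v)"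
proof -
  have "continuous_on UNIV (\<lambda>q :: (nat \<Rightarrow> path \<Rightarrow> real) \<times> 'a::euclidean_space. fst q i p)" for i p
  proof -
    have "continuous_on UNIV (\<lambda>q :: (nat \<Rightarrow> path \<Rightarrow> real) \<times> 'a::euclidean_space. fst q i)"
      by (rule continuous_on_product_then_coordinatewise) (intro continuous_intros)
    then show ?thesis
      by (rule continuous_on_product_then_coordinatewise)
  qed
  then show ?thesis
    unfolding gains_def by (intro continuous_intros) auto
qed

text \<open>Each pair with \<open>norm h = 1\<close> loses a definite amount on some path, and this
  persists in a neighbourhood. Finitely many such neighbourhoods cover the compact set
  \<open>Q\<close>, so one loss \<delta> serves for all its pairs. Clipping reduces arbitrary
  strategies to \<open>Q\<close>, and scaling reduces h to norm 1.\<close>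

lemma robust_no_arbitrage:
  fixes g :: "path \<Rightarrow> 'a::euclidean_space"
  assumes D: "widening T D \<eta> R"
    and g: "\<And>s. s \<in> paths T D \<Longrightarrow> norm (g s) \<le> G"
    and na: "\<forall>H\<in>strategies T D. \<forall>h. h \<noteq> 0 \<longrightarrow> (\<exists>s\<in>paths T D. gains T H s + h \<bullet> g s < 0)"
  obtains \<delta> where "0 < \<delta>"
    and "\<And>H h y. (\<And>s. s \<in> paths T D \<Longrightarrow> - y \<le> gains T H s + h \<bullet> g s) \<Longrightarrow> \<delta> * norm h \<le> y"
proof -
  \<comment> \<open>If the total stays above -1 and \<open>norm h = 1\<close>, the gains stay above
    -(1 + G), and this is the resulting bound on positions.\<close>
  define C where "C = (1 + R / \<eta>) ^ T / \<eta> * (1 + G)"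
  define Q :: "((nat \<Rightarrow> path \<Rightarrow> real) \<times> 'a::euclidean_space) set"
    where "Q = {H. \<forall>i p. H i p \<in> {- C..C}} \<times> sphere 0 1"
  \<comment> \<open>The index pairs a path with a number k that quantifies the strict loss as 1/(k +
    1), so that a finite subcover yields a positive minimum.\<close>
  define U where "U = (\<lambda>z. {q :: (nat \<Rightarrow> path \<Rightarrow> real) \<times> 'a::euclidean_space.
      gains T (fst q) (fst z) + snd q \<bullet> g (fst z) < - inverse (real (Suc (snd z)))})"
  define I where "I = paths T D \<times> (UNIV :: nat set)"
  have "compact Q"
    unfolding Q_def by (intro compact_Times compact_bounded_strategies compact_sphere)
  moreover have "open (U z)" for z
    unfolding U_def by (intro open_Collect_less continuous_on_gains continuous_intros)
  moreover have "Q \<subseteq> (\<Union>z\<in>I. U z)"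
  proof
    fix q assume q: "q \<in> Q"
    obtain H h where qe: "q = (H, h)" by (cases q)
    with q have "h \<noteq> 0" by (auto simp: Q_def)
    then obtain s where s: "s \<in> paths T D" "gains T (strategy_of T D H) s + h \<bullet> g s < 0"
      using na strategy_of_in_strategies by blast
    then have "0 < - (gains T H s + h \<bullet> g s)"
      by (simp add: gains_strategy_of)
    then obtain k where "inverse (real (Suc k)) < - (gains T H s + h \<bullet> g s)"
      using reals_Archimedean by blast
    then have "q \<in> U (s, k)" by (simp add: U_def qe)
    with s show "q \<in> (\<Union>z\<in>I. U z)" by (auto simp: I_def)
  qed
  ultimately obtain I' where I': "I' \<subseteq> I" "finite I'" "Q \<subseteq> (\<Union>z\<in>I'. U z)"
    by (rule compactE_image) auto
  \<comment> \<open>The inserted 1 covers an empty subcover and gives \<delta> \<le> 1, which makes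
    the choice of \<open>C\<close> sufficient.\<close>
  define \<delta> where "\<delta> = Min (insert 1 ((\<lambda>z. inverse (real (Suc (snd z)))) ` I'))"
  have \<delta>: "0 < \<delta>" "\<delta> \<le> 1" and \<delta>le: "\<And>z. z \<in> I' \<Longrightarrow> \<delta> \<le> inverse (real (Suc (snd z)))"
    using I'(2) by (auto simp: \<delta>_def)
  have unit: "\<delta> \<le> y" if low: "\<And>s. s \<in> paths T D \<Longrightarrow> - y \<le> gains T H s + h \<bullet> g s"
    and h: "norm h = 1" for H h y
  proof (rule ccontr)
    assume "\<not> \<delta> \<le> y"
    \<comment> \<open>Along admissible paths the values already lie in \<open>{- C..C}\<close>, so
      clipping preserves the gains. It only changes values at irrelevant arguments, where membership
      in \<open>Q\<close> requires a bound too.\<close>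
    define H' where "H' = (\<lambda>i p. max (- C) (min C (H i p)))"
    have G: "0 \<le> G"
      using g[OF constant_path_in_paths[OF D]] norm_ge_zero order_trans by blast
    have C: "0 \<le> C"
      using wideningD(1,2)[OF D] G by (simp add: C_def)
    have lowH: "- (1 + G) \<le> gains T H s" if s: "s \<in> paths T D" for s
    proof -
      have "h \<bullet> g s \<le> norm h * norm (g s)"
        by (rule norm_cauchy_schwarz)
      then show ?thesis
        using low[OF s] g[OF s] h \<open>\<not> \<delta> \<le> y\<close> \<delta> by simp
    qed
    have "gains T H' s = gains T H s" if s: "s \<in> paths T D" for s
      unfolding gains_def
    proof (rule sum.cong)
      fix i assume "i \<in> {0..<T}"
      then have "\<bar>H i (restrict s {1..i})\<bar> \<le> C"
        unfolding C_def using strategy_bounded[OF D lowH s] by simp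
      then show "H' i (restrict s {1..i}) * (s (i + 1) - s i) =
          H i (restrict s {1..i}) * (s (i + 1) - s i)"
        by (simp add: H'_def max_def min_def abs_le_iff)
    qed simp
    moreover have "(H', h) \<in> Q"
      using C h by (auto simp: Q_def H'_def)
    with I' obtain s k where sk: "(s, k) \<in> I'" "(H', h) \<in> U (s, k)" by force
    moreover have "s \<in> paths T D" using sk I' by (auto simp: I_def)
    ultimately have "gains T H s + h \<bullet> g s < - \<delta>"
      using \<delta>le[OF sk(1)] by (simp add: U_def)
    then show False
      using low[OF \<open>s \<in> paths T D\<close>] \<open>\<not> \<delta> \<le> y\<close> by simp
  qed
  show ?thesis
  proof (rule that[OF \<delta>(1)])
    fix H h y assume low: "\<And>s. s \<in> paths T D \<Longrightarrow> - y \<le> gains T H s + h \<bullet> g s"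
    show "\<delta> * norm h \<le> y"
    proof (cases "h = 0")
      case True
      then show ?thesis
        using low[OF constant_path_in_paths[OF D]] by (simp add: gains_constant_path)
    next
      case False
      define r where "r = inverse (norm h)"
      have r: "0 < r" using False by (simp add: r_def)
      have "- (r * y) \<le> gains T (\<lambda>i p. r * H i p) s + (r *\<^sub>R h) \<bullet> g s" if "s \<in> paths T D" for s
        using mult_left_mono[OF low[OF that], of r] r by (simp add: gains_scale algebra_simps)
      then have "\<delta> \<le> r * y"
        by (rule unit) (simp_all add: r_def False)
      then show ?thesis
        using False by (simp add: r_def field_simps)
    qed
  qed
qed

subsection \<open>Snapping paths to the grid\<close>

text \<open>Rounding down cannot exceed an upper bound, and it respects every lower bound that lies
  on the grid. Hence it keeps prices inside intervals whose lower end points are grid points, and it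
  fixes the initial price 1.\<close>

definition snap :: "nat \<Rightarrow> real \<Rightarrow> real" where
  "snap n x = of_int \<lfloor>x * 2 ^ n\<rfloor> / 2 ^ n"

definition snap_path :: "nat \<Rightarrow> nat \<Rightarrow> path \<Rightarrow> path" where
  "snap_path T n s = (\<lambda>i\<in>{0..T}. snap n (s i))"

lemma snap_le: "snap n x \<le> x"
  by (simp add: snap_def divide_le_eq)

lemma snap_close: "\<bar>snap n x - x\<bar> \<le> 1 / 2 ^ n"
proof -
  have "x * 2 ^ n < of_int \<lfloor>x * 2 ^ n\<rfloor> + 1"
    by linarith
  then have "x \<le> snap n x + 1 / 2 ^ n"
    by (simp add: snap_def field_simps)
  with snap_le[of n x] show ?thesis by simp
qed

lemma snap_in_grid:
  assumes "0 \<le> x" shows "snap n x \<in> grid n"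
proof -
  have "snap n x = real (nat \<lfloor>x * 2 ^ n\<rfloor>) / 2 ^ n"
    using assms by (simp add: snap_def)
  then show ?thesis unfolding grid_def by blast
qed

lemma snap_ge:
  assumes "y \<in> grid n" "y \<le> x" shows "y \<le> snap n x"
proof -
  obtain k where k: "y = real k / 2 ^ n"
    using assms(1) by (auto simp: grid_def)
  with assms(2) have "real k \<le> x * 2 ^ n"
    by (simp add: field_simps)
  then have "int k \<le> \<lfloor>x * 2 ^ n\<rfloor>"
    by (simp add: le_floor_iff)
  then show ?thesis
    using k by (simp add: snap_def divide_right_mono)
qed

lemma one_in_grid: "1 \<in> grid n"
  unfolding grid_def by (rule CollectI, rule exI[of _ "2 ^ n"]) simp

lemma snap_one: "snap n 1 = 1"
  using snap_le[of n 1] snap_ge[OF one_in_grid, of 1 n] by simp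

lemma eventually_in_grid:
  assumes "x \<in> dyadics" shows "\<forall>\<^sub>F n in sequentially. x \<in> grid n"
proof -
  obtain k m where x: "x = real m / 2 ^ k"
    using assms by (auto simp: dyadics_def)
  show ?thesis
  proof (rule eventually_sequentiallyI[of k])
    fix n assume "k \<le> n"
    then have "x = real (m * 2 ^ (n - k)) / 2 ^ n"
      by (simp add: x field_simps flip: power_add)
    then show "x \<in> grid n"
      unfolding grid_def by blast
  qed
qed

text \<open>The metric of the function type weights the coordinates geometrically: the first ones
  contribute at most 2 / 2 ^ n, the tail at most 1 / 2 ^ n. Beyond T both paths are
  \<open>undefined\<close>. This metric is the one in which uniform continuity is available.\<close>

lemma dist_snap_path:
  assumes "s \<in> paths T D"
  shows "dist (snap_path T n s) s \<le> 3 / 2 ^ n"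
proof -
  have *: "dist (snap_path T n s i) (s i) \<le> 1 / 2 ^ n" for i
  proof (cases "i \<le> T")
    case True
    then show ?thesis using snap_close[of n "s i"] by (simp add: snap_path_def dist_real_def)
  next
    case False
    then have "s i = undefined"
      using assms unfolding paths_def by (intro PiE_arb) auto
    with False show ?thesis by (simp add: snap_path_def)
  qed
  let ?A = "{dist (snap_path T n s (from_nat k)) (s (from_nat k)) | k. k \<le> n}"
  have "Max ?A \<le> 1 / 2 ^ n"
    using * by (subst Max_le_iff) auto
  moreover have "dist (snap_path T n s) s \<le> 2 * Max ?A + (1 / 2) ^ n"
    by (rule dist_fun_le_dist_first_terms)
  ultimately show ?thesis
    by (simp add: power_one_over)
qed

lemma path_dist_snap_path: "path_dist T s (snap_path T n s) \<le> 1 / 2 ^ n"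
proof -
  have "\<bar>s i - snap_path T n s i\<bar> \<le> 1 / 2 ^ n" if "i \<in> {0..T}" for i
    using snap_close[of n "s i"] that by (simp add: snap_path_def abs_minus_commute)
  then show ?thesis
    unfolding path_dist_def by (subst Max_le_iff) auto
qed

lemma path_dist_nonneg: "0 \<le> path_dist T s1 s2"
proof -
  have "\<bar>s1 0 - s2 0\<bar> \<le> path_dist T s1 s2"
    unfolding path_dist_def by (intro Max_ge) auto
  then show ?thesis by (rule order_trans[OF abs_ge_zero])
qed

lemma compact_paths:
  assumes "\<And>i. i \<le> T \<Longrightarrow> compact (D i)"
  shows "compact (paths T D)"
proof -
  \<comment> \<open>Extensionality is expressed as a singleton factor, which makes the set a full
    product of compact sets.\<close>
  let ?D = "\<lambda>i. if i \<in> {0..T} then D i else {undefined}"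
  have "paths T D = (\<Pi>\<^sub>E i\<in>UNIV. ?D i)"
    by (auto simp: paths_def PiE_iff extensional_def split: if_splits)
  moreover have "compact (\<Pi>\<^sub>E i\<in>UNIV. ?D i)"
    using compactin_PiE[of "\<lambda>_::nat. euclidean :: real topology" UNIV ?D] assms
    by (simp add: euclidean_product_topology)
  ultimately show ?thesis by simp
qed

text \<open>The position that \<open>H\<close> prescribes for the rounded prices. Rounding acts on
  each coordinate separately, so only prices up to time i are read.\<close>

definition lift_strategy :: "nat \<Rightarrow> (nat \<Rightarrow> path \<Rightarrow> real) \<Rightarrow> nat \<Rightarrow> path \<Rightarrow> real" where
  "lift_strategy n H i p = H i (\<lambda>j\<in>{1..i}. snap n (p j))"

section \<open>Interval prices and their rounding to the grid\<close>

locale price_bounds =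
  fixes T :: nat and a b :: "nat \<Rightarrow> real"
  assumes bounds: "i \<in> {1..T} \<Longrightarrow> 0 \<le> a i \<and> a i < 1 \<and> 1 < b i"
    and bounds_strict: "i \<in> {1..<T} \<Longrightarrow> a (Suc i) < a i \<and> b i < b (Suc i)"
begin

abbreviation "\<Omega> \<equiv> paths T (prices a b)"
abbreviation "\<Omega>\<^sub>G n \<equiv> paths T (grid_prices a b n)"

definition ends_in_grid :: "nat \<Rightarrow> bool" where
  "ends_in_grid n \<longleftrightarrow> (\<forall>i\<in>{1..T}. a i \<in> grid n \<and> b i \<in> grid n)"

lemma grid_paths_subset: "\<Omega>\<^sub>G n \<subseteq> \<Omega>"
  by (rule paths_mono) (auto simp: grid_prices_def)

lemma compact_\<Omega>: "compact \<Omega>"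
  by (rule compact_paths) (simp add: prices_def)

lemma snap_path_in_grid_paths:
  assumes "ends_in_grid n" "s \<in> \<Omega>"
  shows "snap_path T n s \<in> \<Omega>\<^sub>G n"
  unfolding snap_path_def paths_def
proof (rule restrict_PiE_iff[THEN iffD2], intro ballI)
  fix i assume i: "i \<in> {0..T}"
  then have s: "s i \<in> prices a b i" using path_mem[OF assms(2), of i] by simp
  show "snap n (s i) \<in> grid_prices a b n i"
  proof (cases "i = 0")
    case True
    then show ?thesis using s by (simp add: grid_prices_def prices_def snap_one one_in_grid)
  next
    case False
    then have i: "i \<in> {1..T}" using i by simp
    have "a i \<le> s i" "s i \<le> b i"
      using s False by (auto simp: prices_def)
    moreover have "a i \<le> snap n (s i)"
      using assms(1) i calculation by (intro snap_ge) (auto simp: ends_in_grid_def)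
    moreover have "snap n (s i) \<le> b i"
      using snap_le[of n "s i"] calculation by simp
    moreover have "snap n (s i) \<in> grid n"
      using bounds[OF i] calculation by (intro snap_in_grid) auto
    ultimately show ?thesis
      using False by (simp add: grid_prices_def prices_def)
  qed
qed

text \<open>The intervals are strictly nested, so \<eta> can be the least of the finitely many gaps
  between consecutive end points. Jumps to the end points suffice, and these lie on the grid, so the
  same constants serve the grid markets.\<close>

lemma widening_prices:
  obtains \<eta> R where "widening T (prices a b) \<eta> R"
    and "\<And>n. ends_in_grid n \<Longrightarrow> widening T (grid_prices a b n) \<eta> R"
proof -
  \<comment> \<open>Time 0 is treated as the degenerate interval from 1 to 1, so that the first step
    needs no separate case.\<close>
  define lo where "lo = (\<lambda>i. if i = 0 then 1 else a i)"
  define hi where "hi = (\<lambda>i. if i = 0 then 1 else b i)"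
  have prices: "prices a b i = {lo i..hi i}" for i
    by (simp add: prices_def lo_def hi_def)
  have nested: "lo (Suc i) < lo i \<and> lo i \<le> hi i \<and> hi i < hi (Suc i)" if "i < T" for i
    using bounds[of "Suc i"] bounds[of i] bounds_strict[of i] that by (auto simp: lo_def hi_def)
  define \<eta> where
    "\<eta> = Min (insert 1 ((\<lambda>i. min (lo i - lo (Suc i)) (hi (Suc i) - hi i)) ` {..<T}))"
  define R where "R = (\<Sum>i\<le>T. 2 * (\<bar>lo i\<bar> + \<bar>hi i\<bar>))"
  have \<eta>: "0 < \<eta>"
    using nested by (auto simp: \<eta>_def)
  have \<eta>le: "\<eta> \<le> lo i - lo (Suc i) \<and> \<eta> \<le> hi (Suc i) - hi i" if "i < T" for i
  proof -
    have "\<eta> \<le> min (lo i - lo (Suc i)) (hi (Suc i) - hi i)"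
      unfolding \<eta>_def using that by (intro Min_le) auto
    then show ?thesis by simp
  qed
  have R: "0 \<le> R"
    unfolding R_def by (intro sum_nonneg) simp
  have range: "\<bar>y - x\<bar> \<le> R" if "i < T" "x \<in> prices a b i" "y \<in> prices a b (Suc i)" for i x y
  proof -
    have "2 * (\<bar>lo (Suc i)\<bar> + \<bar>hi (Suc i)\<bar>) \<le> R"
      unfolding R_def using that(1)
      by (intro member_le_sum[of "Suc i" "{..T}" "\<lambda>i. 2 * (\<bar>lo i\<bar> + \<bar>hi i\<bar>)"]) auto
    then show ?thesis
      using that nested[of i] by (simp add: prices) linarith
  qed
  have ends: "x \<in> prices a b (Suc i) \<and> lo (Suc i) + \<eta> \<le> x \<and> x + \<eta> \<le> hi (Suc i)"
    "lo (Suc i) \<in> prices a b (Suc i)" "hi (Suc i) \<in> prices a b (Suc i)"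
    if "i < T" "x \<in> prices a b i" for i x
    using that nested[of i] \<eta>le[of i] \<eta> by (auto simp: prices)
  have ends_grid: "lo (Suc i) \<in> grid n" "hi (Suc i) \<in> grid n" if "i < T" "ends_in_grid n" for i n
    using that by (auto simp: lo_def hi_def ends_in_grid_def)
  show thesis
  proof (rule that)
    show "widening T (prices a b) \<eta> R"
      unfolding widening_def
    proof (intro conjI allI impI ballI)
      show "1 \<in> prices a b 0"
        by (simp add: prices_def)
      fix i x assume ix: "i < T" "x \<in> prices a b i"
      show "x \<in> prices a b (Suc i)" "\<exists>l\<in>prices a b (Suc i). l + \<eta> \<le> x"
        "\<exists>u\<in>prices a b (Suc i). x + \<eta> \<le> u"
        using ix ends by blast+
      show "\<bar>y - x\<bar> \<le> R" if "y \<in> prices a b (Suc i)" for y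
        using ix that range by blast
    qed (fact \<eta> R)+
    fix n assume n: "ends_in_grid n"
    show "widening T (grid_prices a b n) \<eta> R"
      unfolding widening_def grid_prices_def
    proof (intro conjI allI impI ballI)
      show "1 \<in> prices a b 0 \<inter> grid n"
        by (simp add: prices_def one_in_grid)
      fix i x assume ix: "i < T" "x \<in> prices a b i \<inter> grid n"
      show "x \<in> prices a b (Suc i) \<inter> grid n"
        using ix ends by blast
      show "\<exists>l\<in>prices a b (Suc i) \<inter> grid n. l + \<eta> \<le> x"
        using ix ends ends_grid[OF ix(1) n] by blast
      show "\<exists>u\<in>prices a b (Suc i) \<inter> grid n. x + \<eta> \<le> u"
        using ix ends ends_grid[OF ix(1) n] by blast
      show "\<bar>y - x\<bar> \<le> R" if "y \<in> prices a b (Suc i) \<inter> grid n" for y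
        using ix that range by blast
    qed (fact \<eta> R)+
  qed
qed

text \<open>The lifted strategy holds along \<open>s\<close> the positions that \<open>H\<close>
  holds along the rounded path, so only the price increments differ, each by at most 2 / 2 ^ n. The
  positions are bounded since \<open>H\<close> alone loses at most M - x on the grid. The term
  \<open>F\<close> stands for the other payoffs: the static options, with or without the American
  one.\<close>

lemma gains_lift_strategy:
  assumes n: "ends_in_grid n" and D: "widening T (grid_prices a b n) \<eta> R"
    and low: "\<And>p. p \<in> \<Omega>\<^sub>G n \<Longrightarrow> x \<le> gains T H p + F p"
    and F: "\<And>p. p \<in> \<Omega>\<^sub>G n \<Longrightarrow> F p \<le> M" and s: "s \<in> \<Omega>"
  shows "x - 2 * real T * ((1 + R / \<eta>) ^ T / \<eta>) * (1 / 2 ^ n) * (M - x)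
      \<le> gains T (lift_strategy n H) s + F (snap_path T n s)"
proof -
  define p where "p = snap_path T n s"
  define C where "C = (1 + R / \<eta>) ^ T / \<eta> * (M - x)"
  have p: "p \<in> \<Omega>\<^sub>G n"
    unfolding p_def by (rule snap_path_in_grid_paths[OF n s])
  have "- (M - x) \<le> gains T H p" if "p \<in> \<Omega>\<^sub>G n" for p
    using low[OF that] F[OF that] by simp
  then have H: "\<bar>H i (restrict p {1..i})\<bar> \<le> C" if "i < T" for i
    unfolding C_def using strategy_bounded[OF D _ p that] by simp
  have "\<bar>gains T (lift_strategy n H) s - gains T H p\<bar> \<le> (\<Sum>i\<in>{0..<T}. C * (2 / 2 ^ n))"
    unfolding gains_def sum_subtractf[symmetric]
  proof (rule sum_abs[THEN order_trans], rule sum_mono)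
    fix i assume i: "i \<in> {0..<T}"
    have lift: "lift_strategy n H i (restrict s {1..i}) = H i (restrict p {1..i})"
      unfolding lift_strategy_def using i
      by (intro arg_cong[where f = "H i"] restrict_ext) (simp add: p_def snap_path_def)
    have "\<bar>s (i + 1) - s i - (p (i + 1) - p i)\<bar> \<le> 2 / 2 ^ n"
      using i snap_close[of n "s i"] snap_close[of n "s (i + 1)"]
      by (simp add: p_def snap_path_def)
    moreover have "\<bar>H i (restrict p {1..i})\<bar> \<le> C"
      using H[of i] i by simp
    ultimately have "\<bar>H i (restrict p {1..i}) * (s (i + 1) - s i - (p (i + 1) - p i))\<bar> \<le> C * (2 / 2 ^ n)"
      unfolding abs_mult by (intro mult_mono) auto
    then show "\<bar>lift_strategy n H i (restrict s {1..i}) * (s (i + 1) - s i) -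
        H i (restrict p {1..i}) * (p (i + 1) - p i)\<bar> \<le> C * (2 / 2 ^ n)"
      unfolding lift by (simp only: right_diff_distrib)
  qed
  also have "\<dots> = 2 * real T * ((1 + R / \<eta>) ^ T / \<eta>) * (1 / 2 ^ n) * (M - x)"
    by (simp add: C_def)
  finally show ?thesis
    using low[OF p] unfolding p_def by simp
qed

section \<open>Oscillation of payoffs under rounding\<close>

definition osc :: "nat \<Rightarrow> (path \<Rightarrow> 'x::real_normed_vector) \<Rightarrow> real" where
  "osc n f = (SUP s\<in>\<Omega>. norm (f s - f (snap_path T n s)))"

lemma \<Omega>_nonempty: "\<Omega> \<noteq> {}"
  using widening_prices constant_path_in_paths by (metis empty_iff)

lemma osc_le:
  assumes "\<And>s. s \<in> \<Omega> \<Longrightarrow> norm (f s - f (snap_path T n s)) \<le> e"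
  shows "osc n f \<le> e"
  unfolding osc_def by (rule cSUP_least[OF \<Omega>_nonempty assms])

lemma snap_path_in_\<Omega>: "ends_in_grid n \<Longrightarrow> s \<in> \<Omega> \<Longrightarrow> snap_path T n s \<in> \<Omega>"
  using snap_path_in_grid_paths grid_paths_subset by blast

lemma bounded_on_\<Omega>:
  assumes "continuous_on \<Omega> f"
  obtains B where "0 \<le> B" "\<And>s. s \<in> \<Omega> \<Longrightarrow> norm (f s) \<le> B"
proof -
  have "bounded (f ` \<Omega>)"
    using compact_continuous_image[OF assms compact_\<Omega>] by (rule compact_imp_bounded)
  then obtain B where "0 < B" "\<And>s. s \<in> \<Omega> \<Longrightarrow> norm (f s) \<le> B"
    unfolding bounded_pos by auto
  then show ?thesis using that less_imp_le by blast
qed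

lemma norm_diff_snap_le_osc:
  assumes f: "continuous_on \<Omega> f" and n: "ends_in_grid n" and s: "s \<in> \<Omega>"
  shows "norm (f s - f (snap_path T n s)) \<le> osc n f"
proof -
  obtain B where B: "\<And>s. s \<in> \<Omega> \<Longrightarrow> norm (f s) \<le> B"
    using bounded_on_\<Omega>[OF f] by blast
  have "norm (f s - f (snap_path T n s)) \<le> B + B" if "s \<in> \<Omega>" for s
    using B[OF that] B[OF snap_path_in_\<Omega>[OF n that]] norm_triangle_ineq4 by (smt (verit))
  then show ?thesis
    unfolding osc_def using s by (intro cSUP_upper bdd_aboveI2)
qed

lemma osc_nonneg:
  assumes "continuous_on \<Omega> f" "ends_in_grid n"
  shows "0 \<le> osc n f"
  using norm_diff_snap_le_osc[OF assms] \<Omega>_nonempty norm_ge_zero order_trans by (metis ex_in_conv)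

text \<open>A continuous function on the compact set \<Omega> is uniformly continuous, and rounding
  moves every path by at most 3 / 2 ^ n.\<close>

lemma osc_tendsto_0:
  assumes f: "continuous_on \<Omega> f" and ends: "\<forall>\<^sub>F n in sequentially. ends_in_grid n"
  shows "(\<lambda>n. osc n f) \<longlonglongrightarrow> 0"
proof (rule tendstoI)
  fix e :: real assume e: "0 < e"
  have "uniformly_continuous_on \<Omega> f"
    using f compact_\<Omega> by (rule compact_uniformly_continuous)
  then obtain d where d: "0 < d"
    "\<And>s s'. s \<in> \<Omega> \<Longrightarrow> s' \<in> \<Omega> \<Longrightarrow> dist s' s < d \<Longrightarrow> dist (f s') (f s) < e / 2"
    unfolding uniformly_continuous_on_def using e by (metis half_gt_zero)
  have "(\<lambda>n. 3 * (1 / 2) ^ n :: real) \<longlonglongrightarrow> 3 * 0"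
    by (intro tendsto_intros LIMSEQ_power_zero) simp
  then have "\<forall>\<^sub>F n in sequentially. 3 * (1 / 2) ^ n < d"
    using d(1) by (intro order_tendstoD(2)) auto
  with ends show "\<forall>\<^sub>F n in sequentially. dist (osc n f) 0 < e"
  proof eventually_elim
    case (elim n)
    have "norm (f s - f (snap_path T n s)) \<le> e / 2" if s: "s \<in> \<Omega>" for s
    proof -
      have "dist (snap_path T n s) s < d"
        using dist_snap_path[OF s, of n] elim(2) by (simp add: power_one_over)
      then show ?thesis
        using d(2)[OF s snap_path_in_\<Omega>[OF elim(1) s]] by (simp add: dist_norm norm_minus_commute)
    qed
    then have "osc n f \<le> e / 2"
      by (rule osc_le)
    with osc_nonneg[OF f elim(1)] e show ?case by (simp add: dist_real_def)
  qed
qed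

text \<open>The factor \<open>sqrt DIM('x)\<close> passes from the sup norm to the Euclidean norm;
  the absolute value is taken because a Lipschitz constant \<open>L\<close> may be negative.\<close>

lemma osc_lipschitz:
  fixes f :: "path \<Rightarrow> 'x::euclidean_space"
  assumes "lipschitz_paths T (prices a b) f"
  obtains L where "0 \<le> L" "\<And>n. ends_in_grid n \<Longrightarrow> osc n f \<le> L * (1 / 2 ^ n)"
proof -
  obtain L where L: "\<And>s1 s2. s1 \<in> \<Omega> \<Longrightarrow> s2 \<in> \<Omega> \<Longrightarrow> infnorm (f s1 - f s2) \<le> L * path_dist T s1 s2"
    using assms unfolding lipschitz_paths_def by blast
  let ?L = "sqrt DIM('x) * \<bar>L\<bar>"
  have "osc n f \<le> ?L * (1 / 2 ^ n)" if n: "ends_in_grid n" for n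
  proof (rule osc_le)
    fix s assume s: "s \<in> \<Omega>"
    have "infnorm (f s - f (snap_path T n s)) \<le> L * path_dist T s (snap_path T n s)"
      using L[OF s snap_path_in_\<Omega>[OF n s]] .
    also have "\<dots> \<le> \<bar>L\<bar> * (1 / 2 ^ n)"
      using path_dist_snap_path[of T s n] path_dist_nonneg[of T s "snap_path T n s"]
      by (intro mult_mono) auto
    finally have "sqrt DIM('x) * infnorm (f s - f (snap_path T n s)) \<le> ?L * (1 / 2 ^ n)"
      unfolding mult.assoc by (intro mult_left_mono) auto
    then show "norm (f s - f (snap_path T n s)) \<le> ?L * (1 / 2 ^ n)"
      by (rule order_trans[OF norm_le_infnorm])
  qed
  then show ?thesis by (intro that[of ?L]) auto
qed

end

subsection \<open>Comparison of the two markets\<close>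

locale american_market = price_bounds T a b
  for T :: nat and a b :: "nat \<Rightarrow> real" +
  fixes g :: "path \<Rightarrow> real ^ 'e" and \<Phi> :: "nat \<Rightarrow> path \<Rightarrow> real"
  assumes g_cont: "continuous_on \<Omega> g"
    and \<Phi>_cont: "t \<in> {0..T} \<Longrightarrow> continuous_on \<Omega> (\<Phi> t)"
    and no_arbitrage: "\<forall>H\<in>strategies T (prices a b). \<forall>h. h \<noteq> 0 \<longrightarrow>
          (\<exists>s\<in>\<Omega>. gains T H s + h \<bullet> g s < 0)"
    and dyadic: "\<forall>i\<in>{1..T}. a i \<in> dyadics \<and> b i \<in> dyadics"
begin

lemma eventually_ends_in_grid: "\<forall>\<^sub>F n in sequentially. ends_in_grid n"
  unfolding ends_in_grid_def
  by (rule eventually_ball_finite) (use dyadic in \<open>auto intro!: eventually_conj eventually_in_grid\<close>)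

text \<open>Collects all sources of discrepancy between the two markets, so that convergence and
  rate both reduce to estimating one sequence.\<close>

definition error :: "real ^ 'e \<Rightarrow> nat \<Rightarrow> real" where
  "error v n = (\<Sum>t\<le>T. osc n (\<Phi> t)) + osc n g + norm v + 1 / 2 ^ n"

lemma error_tendsto_0:
  assumes "(\<lambda>n. norm (c n)) \<longlonglongrightarrow> 0"
  shows "(\<lambda>n. error (c n) n) \<longlonglongrightarrow> 0"
proof -
  have "(\<lambda>n. (1 / 2) ^ n :: real) \<longlonglongrightarrow> 0"
    by (intro LIMSEQ_power_zero) simp
  then have "(\<lambda>n. error (c n) n) \<longlonglongrightarrow> (\<Sum>t\<le>T. 0) + 0 + 0 + 0"
    unfolding error_def power_one_over
    by (intro tendsto_intros osc_tendsto_0 eventually_ends_in_grid g_cont \<Phi>_cont assms) auto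
  then show ?thesis by simp
qed

lemma error_lipschitz:
  assumes g: "lipschitz_paths T (prices a b) g"
    and \<Phi>: "\<forall>t\<in>{0..T}. lipschitz_paths T (prices a b) (\<Phi> t)"
    and c: "\<forall>\<^sub>F n in sequentially. norm (c n) \<le> B * (1 / 2 ^ n)"
  obtains C where "\<forall>\<^sub>F n in sequentially. error (c n) n \<le> C * (1 / 2 ^ n)"
proof -
  obtain L where L: "\<And>n. ends_in_grid n \<Longrightarrow> osc n g \<le> L * (1 / 2 ^ n)"
    using osc_lipschitz[OF g] by blast
  have "\<exists>L. \<forall>n. ends_in_grid n \<longrightarrow> osc n (\<Phi> t) \<le> L * (1 / 2 ^ n)" if "t \<le> T" for t
    using osc_lipschitz[of "\<Phi> t"] \<Phi> that by (metis atLeastAtMost_iff zero_le)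
  then obtain L' where L': "\<And>t n. t \<le> T \<Longrightarrow> ends_in_grid n \<Longrightarrow> osc n (\<Phi> t) \<le> L' t * (1 / 2 ^ n)"
    by metis
  show ?thesis
  proof (rule that)
    show "\<forall>\<^sub>F n in sequentially. error (c n) n \<le> ((\<Sum>t\<le>T. L' t) + L + B + 1) * (1 / 2 ^ n)"
      using eventually_ends_in_grid c
    proof eventually_elim
      case (elim n)
      have "(\<Sum>t\<le>T. osc n (\<Phi> t)) \<le> (\<Sum>t\<le>T. L' t * (1 / 2 ^ n))"
        using L' elim(1) by (intro sum_mono) auto
      then have "(\<Sum>t\<le>T. osc n (\<Phi> t)) \<le> (\<Sum>t\<le>T. L' t) * (1 / 2 ^ n)"
        unfolding sum_distrib_right .
      with L[OF elim(1)] elim(2) show ?case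
        unfolding error_def distrib_right by linarith
    qed
  qed
qed

lemma bound_\<Phi>:
  obtains M where "0 \<le> M" "\<And>t s. t \<le> T \<Longrightarrow> s \<in> \<Omega> \<Longrightarrow> \<bar>\<Phi> t s\<bar> \<le> M"
proof -
  have "\<exists>B. 0 \<le> B \<and> (\<forall>s\<in>\<Omega>. norm (\<Phi> t s) \<le> B)" if "t \<le> T" for t
    using bounded_on_\<Omega>[OF \<Phi>_cont[of t]] that by (metis atLeastAtMost_iff zero_le)
  then obtain B where B: "\<And>t. t \<le> T \<Longrightarrow> 0 \<le> B t \<and> (\<forall>s\<in>\<Omega>. norm (\<Phi> t s) \<le> B t)"
    by metis
  have "\<bar>\<Phi> t s\<bar> \<le> (\<Sum>t\<le>T. B t)" if "t \<le> T" "s \<in> \<Omega>" for t s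
    using B that member_le_sum[of t "{..T}" B] by fastforce
  with B show ?thesis by (intro that[of "\<Sum>t\<le>T. B t"] sum_nonneg) auto
qed

text \<open>Every relevant hedge of either market becomes a hedge of the other at a cost of at most
  K times the error, with K independent of n. This single estimate yields both the limit and the
  rate.\<close>

lemma price_comparison:
  assumes c: "(\<lambda>n. norm (c n)) \<longlonglongrightarrow> 0"
  obtains r K where "sub_hedging_price T (prices a b) g \<Phi> = ereal r"
    and "\<forall>\<^sub>F n in sequentially. \<exists>r'.
      sub_hedging_price T (grid_prices a b n) (\<lambda>s. g s - c n) \<Phi> = ereal r' \<and>
      \<bar>r' - r\<bar> \<le> K * error (c n) n"
proof -
  obtain \<eta> R where D: "widening T (prices a b) \<eta> R"
    and Dn: "\<And>n. ends_in_grid n \<Longrightarrow> widening T (grid_prices a b n) \<eta> R"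
    using widening_prices by blast
  obtain G where G: "0 \<le> G" "\<And>s. s \<in> \<Omega> \<Longrightarrow> norm (g s) \<le> G"
    using bounded_on_\<Omega>[OF g_cont] by blast
  obtain M where M: "0 \<le> M" "\<And>t s. t \<le> T \<Longrightarrow> s \<in> \<Omega> \<Longrightarrow> \<bar>\<Phi> t s\<bar> \<le> M"
    using bound_\<Phi> by blast
  obtain \<delta> where \<delta>: "0 < \<delta>"
    and robust: "\<And>H h y. (\<And>s. s \<in> \<Omega> \<Longrightarrow> - y \<le> gains T H s + h \<bullet> g s) \<Longrightarrow> \<delta> * norm h \<le> y"
    using robust_no_arbitrage[OF D G(2) no_arbitrage] by blast
  define k where "k = 2 * real T * ((1 + R / \<eta>) ^ T / \<eta>)"
  have k: "0 \<le> k"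
    using wideningD(1,2)[OF D] by (simp add: k_def)
  \<comment> \<open>A hedge of value x \<ge> -M leaves losses of at most 2 * M to be covered by
    trading. The weaker robustness constant \<delta> / 4 of the grid markets then bounds h by this
    number.\<close>
  define B where "B = 8 * M / \<delta>"
  have B: "0 \<le> B" using M \<delta> by (simp add: B_def)
  \<comment> \<open>Bounds the loss of the dynamic part of a grid hedge of value at least -M: M for
    the American payoff, B * (G + 1) for the options, M for the value itself.\<close>
  define M' where "M' = 2 * M + B * (G + 1)"
  have M': "0 \<le> M'" using M B G by (simp add: M'_def)
  \<comment> \<open>The summands pay for the oscillation of \<Phi>, for the change in the options
    under a position of size B, and for the rounded price increments.\<close>
  define K where "K = 1 + B + k * M'"
  define P where "P = {x. \<exists>H \<tau> h. stops T (prices a b) \<tau> \<and>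
    subhedges T (prices a b) g \<Phi> H \<tau> h x}"
  define P' where "P' = (\<lambda>n. {x. \<exists>H \<tau> h. stops T (grid_prices a b n) \<tau> \<and>
    subhedges T (grid_prices a b n) (\<lambda>s. g s - c n) \<Phi> H \<tau> h x})"

  \<comment> \<open>No trading and stopping at time 0 secures -M.\<close>
  have M_in: "- M \<in> P"
  proof -
    have "stops T (prices a b) (\<lambda>_. 0)" by (simp add: stops_def)
    moreover have "subhedges T (prices a b) g \<Phi> (\<lambda>_ _. 0) (\<lambda>_. 0) 0 (- M)"
      using M(2)[of 0] by (fastforce simp: subhedges_def gains_def)
    ultimately show ?thesis unfolding P_def by blast
  qed
  have M_in': "- M \<in> P' n" for n
  proof -
    have "stops T (grid_prices a b n) (\<lambda>_. 0)" by (simp add: stops_def)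
    moreover have "subhedges T (grid_prices a b n) (\<lambda>s. g s - c n) \<Phi> (\<lambda>_ _. 0) (\<lambda>_. 0) 0 (- M)"
      using M(2)[of 0] grid_paths_subset by (fastforce simp: subhedges_def gains_def)
    ultimately show ?thesis unfolding P'_def by blast
  qed
  have hedge: "\<delta> * norm h \<le> M - x"
    if "stops T (prices a b) \<tau>" "subhedges T (prices a b) g \<Phi> H \<tau> h x" for \<tau> H h x
  proof (rule robust)
    fix s assume s: "s \<in> \<Omega>"
    show "- (M - x) \<le> gains T H s + h \<bullet> g s"
      using subhedgesD[OF that(2) s] M(2)[OF stops_le[OF that(1) s] s] by simp
  qed
  have P_le: "x \<le> M" if "x \<in> P" for x
    using that hedge \<delta> unfolding P_def
    by (smt (verit) mem_Collect_eq mult_nonneg_nonneg norm_ge_zero)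

  \<comment> \<open>For large n the perturbation proportional to \<open>norm h\<close> falls below
    half of \<delta>, which is what carries robustness over to the grid.\<close>
  have "(\<lambda>n. osc n g + norm (c n) + k * (1 / 2) ^ n * (G + 1)) \<longlonglongrightarrow> 0 + 0 + k * 0 * (G + 1)"
    by (intro tendsto_intros osc_tendsto_0 eventually_ends_in_grid g_cont c LIMSEQ_power_zero) simp
  then have "\<forall>\<^sub>F n in sequentially. osc n g + norm (c n) + k * (1 / 2) ^ n * (G + 1) < \<delta> / 2"
    using \<delta> by (intro order_tendstoD(2)) auto
  moreover have "(\<lambda>n. k * (1 / 2) ^ n) \<longlonglongrightarrow> k * 0"
    by (intro tendsto_intros LIMSEQ_power_zero) simp
  then have "\<forall>\<^sub>F n in sequentially. k * (1 / 2) ^ n < 1"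
    by (intro order_tendstoD(2)) auto
  moreover have "\<forall>\<^sub>F n in sequentially. norm (c n) < 1"
    using c by (intro order_tendstoD(2)) auto
  ultimately have "\<forall>\<^sub>F n in sequentially. \<exists>r'.
      sub_hedging_price T (grid_prices a b n) (\<lambda>s. g s - c n) \<Phi> = ereal r' \<and>
      \<bar>r' - Sup P\<bar> \<le> K * error (c n) n"
    using eventually_ends_in_grid
  proof eventually_elim
    case (elim n)
    note n = elim(4) and c1 = elim(3)
    define t where "t = k * (1 / 2 ^ n)"
    have t: "0 \<le> t" "t < 1" and small: "osc n g + norm (c n) + t * (G + 1) < \<delta> / 2"
      using elim(1,2) k by (auto simp: t_def power_one_over)
    have osc_\<Phi>: "0 \<le> osc n (\<Phi> i)" if "i \<le> T" for i
      using \<Phi>_cont[of i] n that by (intro osc_nonneg) auto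
    have osc_g: "0 \<le> osc n g"
      by (rule osc_nonneg[OF g_cont n])
    have net: "\<bar>h \<bullet> (g p - c n)\<bar> \<le> norm h * (G + 1)" if "p \<in> \<Omega>" for h p
    proof -
      have "norm (g p - c n) \<le> G + 1"
        using norm_triangle_ineq4[of "g p" "c n"] G(2)[OF that] c1 by linarith
      then show ?thesis
        using Cauchy_Schwarz_ineq2[of h "g p - c n"] mult_left_mono[of _ _ "norm h"]
        by (meson norm_ge_zero order_trans)
    qed
    have snap_g: "h \<bullet> (g (snap_path T n s) - c n) \<le> h \<bullet> g s + norm h * (osc n g + norm (c n))"
      if s: "s \<in> \<Omega>" for h s
    proof -
      have "norm (g (snap_path T n s) - c n - g s)
          \<le> norm (g s - g (snap_path T n s)) + norm (c n)"
        using norm_triangle_ineq4[of "g (snap_path T n s) - g s" "c n"]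
        by (simp add: algebra_simps norm_minus_commute)
      also have "\<dots> \<le> osc n g + norm (c n)"
        using norm_diff_snap_le_osc[OF g_cont n s] by simp
      finally have "h \<bullet> (g (snap_path T n s) - c n - g s) \<le> norm h * (osc n g + norm (c n))"
        using norm_cauchy_schwarz[of h] mult_left_mono[of _ _ "norm h"]
        by (meson norm_ge_zero order_trans)
      then show ?thesis by (simp add: inner_diff_right)
    qed

    \<comment> \<open>The grid strategy is lifted and tested against robustness in the original
      market. The errors proportional to \<open>norm h\<close> cost half of \<delta>, and those
      proportional to y at most double y because t < 1; hence the constant \<delta> / 4.\<close>
    have robust': "\<delta> / 4 * norm h \<le> y"
      if low: "\<And>p. p \<in> \<Omega>\<^sub>G n \<Longrightarrow> - y \<le> gains T H p + h \<bullet> (g p - c n)" for H h y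
    proof -
      have "- (y + t * (norm h * (G + 1) + y) + norm h * (osc n g + norm (c n)))
          \<le> gains T (lift_strategy n H) s + h \<bullet> g s" if s: "s \<in> \<Omega>" for s
      proof -
        have "- y - k * (1 / 2 ^ n) * (norm h * (G + 1) - (- y))
            \<le> gains T (lift_strategy n H) s + h \<bullet> (g (snap_path T n s) - c n)"
          unfolding k_def
        proof (rule gains_lift_strategy[OF n Dn[OF n] low _ s])
          show "h \<bullet> (g p - c n) \<le> norm h * (G + 1)" if "p \<in> \<Omega>\<^sub>G n" for p
          proof -
            have "p \<in> \<Omega>" using that grid_paths_subset by blast
            from net[OF this, of h] show ?thesis by simp
          qed
        qed
        with snap_g[OF s, of h] show ?thesis by (simp add: t_def)
      qed
      then have "\<delta> * norm h \<le> y + t * (norm h * (G + 1) + y) + norm h * (osc n g + norm (c n))"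
        by (rule robust)
      also have "\<dots> = (1 + t) * y + norm h * (osc n g + norm (c n) + t * (G + 1))"
        by (simp add: algebra_simps)
      also have "\<dots> \<le> (1 + t) * y + norm h * (\<delta> / 2)"
        using small by (intro add_left_mono mult_left_mono) auto
      finally have *: "\<delta> / 2 * norm h \<le> (1 + t) * y" by (simp add: algebra_simps)
      moreover have "0 \<le> \<delta> / 2 * norm h" using \<delta> by simp
      ultimately have "0 \<le> y"
        using t by (smt (verit) mult_pos_neg)
      then have "(1 + t) * y \<le> 2 * y"
        using t by (intro mult_right_mono) auto
      with * show ?thesis by simp
    qed
    have hedge': "\<delta> / 4 * norm h \<le> M - x"
      if "stops T (grid_prices a b n) \<tau>"
        "subhedges T (grid_prices a b n) (\<lambda>s. g s - c n) \<Phi> H \<tau> h x" for \<tau> H h x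
    proof (rule robust')
      fix p assume p: "p \<in> \<Omega>\<^sub>G n"
      then have "p \<in> \<Omega>" using grid_paths_subset by blast
      then show "- (M - x) \<le> gains T H p + h \<bullet> (g p - c n)"
        using subhedgesD[OF that(2) p] M(2)[OF stops_le[OF that(1) p]] by fastforce
    qed
    have P'_le: "x \<le> M" if "x \<in> P' n" for x
      using that hedge' \<delta> unfolding P'_def
      by (smt (verit) divide_pos_pos mem_Collect_eq mult_nonneg_nonneg norm_ge_zero)

    have err: "norm (c n) \<le> error (c n) n" "osc n g + norm (c n) \<le> error (c n) n"
      "1 / 2 ^ n \<le> error (c n) n" "\<And>i. i \<le> T \<Longrightarrow> osc n (\<Phi> i) \<le> (\<Sum>i\<le>T. osc n (\<Phi> i))"
      and err_split: "error (c n) n = (\<Sum>i\<le>T. osc n (\<Phi> i)) + (osc n g + norm (c n)) + 1 / 2 ^ n"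
      and sum_nn: "0 \<le> (\<Sum>i\<le>T. osc n (\<Phi> i))"
    proof -
      show nn: "0 \<le> (\<Sum>i\<le>T. osc n (\<Phi> i))" using osc_\<Phi> by (intro sum_nonneg) auto
      show "osc n (\<Phi> i) \<le> (\<Sum>i\<le>T. osc n (\<Phi> i))" if "i \<le> T" for i
        using osc_\<Phi> that by (intro member_le_sum[of i "{..T}" "\<lambda>i. osc n (\<Phi> i)"]) auto
      show "norm (c n) \<le> error (c n) n" "osc n g + norm (c n) \<le> error (c n) n"
        "1 / 2 ^ n \<le> error (c n) n"
        "error (c n) n = (\<Sum>i\<le>T. osc n (\<Phi> i)) + (osc n g + norm (c n)) + 1 / 2 ^ n"
        using nn osc_g by (simp_all add: error_def)
    qed
    have err0: "0 \<le> error (c n) n"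
      using err(1) norm_ge_zero order_trans by blast
    have total: "(\<Sum>i\<le>T. osc n (\<Phi> i)) + B * (osc n g + norm (c n)) + t * M' \<le> K * error (c n) n"
    proof -
      have "B * (osc n g + norm (c n)) \<le> B * error (c n) n"
        using err B by (intro mult_left_mono) auto
      moreover have "t * M' \<le> k * M' * error (c n) n"
        using mult_left_mono[OF err(3), of "k * M'"] k M' by (simp add: t_def mult_ac)
      moreover have "(\<Sum>i\<le>T. osc n (\<Phi> i)) \<le> error (c n) n"
        using osc_g unfolding err_split by simp
      ultimately show ?thesis by (simp add: K_def distrib_right)
    qed
    have norm_h: "norm h \<le> B" if "\<delta> / 4 * norm h \<le> M - x" "- M \<le> x" for h :: "real ^ 'e" and x
    proof -
      have "\<delta> / 4 * norm h \<le> 2 * M" using that by simp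
      then show ?thesis using \<delta> by (simp add: B_def field_simps)
    qed

    \<comment> \<open>The same strategy is used on the grid; only the option prices change, at a
      cost of \<open>h \<bullet> c n\<close>.\<close>
    have restrict: "x - K * error (c n) n \<in> P' n" if x: "x \<in> P" "- M \<le> x" for x
    proof -
      obtain H \<tau> h where \<tau>: "stops T (prices a b) \<tau>"
        and sub: "subhedges T (prices a b) g \<Phi> H \<tau> h x"
        using x(1) unfolding P_def by blast
      have "\<delta> / 4 * norm h \<le> \<delta> * norm h"
        using \<delta> by (intro mult_right_mono) auto
      then have "norm h \<le> B"
        using hedge[OF \<tau> sub] x(2) by (intro norm_h[of h x]) auto
      then have "norm h * norm (c n) \<le> B * (osc n g + norm (c n))"
        using osc_g B by (intro mult_mono) auto
      also have "\<dots> \<le> K * error (c n) n"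
        using total sum_nn t M' mult_nonneg_nonneg[of t M'] by linarith
      finally have "h \<bullet> c n \<le> K * error (c n) n"
        using norm_cauchy_schwarz[of h "c n"] by linarith
      then have "subhedges T (grid_prices a b n) (\<lambda>s. g s - c n) \<Phi> H \<tau> h (x - K * error (c n) n)"
        using sub grid_paths_subset unfolding subhedges_def inner_diff_right by fastforce
      moreover have "stops T (grid_prices a b n) \<tau>"
        using \<tau> grid_paths_subset by (rule stops_subset)
      ultimately show ?thesis unfolding P'_def by blast
    qed
    have lift: "x - K * error (c n) n \<in> P" if x: "x \<in> P' n" "- M \<le> x" for x
    proof -
      obtain H \<tau> h where \<tau>: "stops T (grid_prices a b n) \<tau>"
        and sub: "subhedges T (grid_prices a b n) (\<lambda>s. g s - c n) \<Phi> H \<tau> h x"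
        using x(1) unfolding P'_def by blast
      have h: "norm h \<le> B"
        using hedge'[OF \<tau> sub] x(2) by (rule norm_h)
      \<comment> \<open>Paths that agree up to time j still agree up to j after rounding, so
        stopping by the rounded path remains nonanticipating.\<close>
      let ?\<tau> = "\<lambda>s. \<tau> (snap_path T n s)"
      have \<tau>': "stops T (prices a b) ?\<tau>"
        unfolding stops_def
      proof (intro conjI ballI allI impI)
        show "?\<tau> s \<le> T" if "s \<in> \<Omega>" for s
          using stops_le[OF \<tau> snap_path_in_grid_paths[OF n that]] .
        fix s1 s2 j assume s: "s1 \<in> \<Omega>" "s2 \<in> \<Omega>" "?\<tau> s1 = j \<and> (\<forall>i\<in>{0..j}. s1 i = s2 i)"
        then have "\<forall>i\<in>{0..j}. snap_path T n s1 i = snap_path T n s2 i"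
          by (simp add: snap_path_def)
        then show "?\<tau> s2 = j"
          using \<tau> snap_path_in_grid_paths[OF n s(1)] snap_path_in_grid_paths[OF n s(2)] s(3)
          unfolding stops_def by blast
      qed
      have "x - K * error (c n) n \<le> \<Phi> (?\<tau> s) s + gains T (lift_strategy n H) s + h \<bullet> g s"
        if s: "s \<in> \<Omega>" for s
      proof -
        define p where "p = snap_path T n s"
        \<comment> \<open>The American payoff and the net options together form the extra payoff in
          \<open>gains_lift_strategy\<close>; their sum is at most M + B * (G + 1).\<close>
        have "x - k * (1 / 2 ^ n) * (M + B * (G + 1) - x)
            \<le> gains T (lift_strategy n H) s + (\<Phi> (\<tau> p) p + h \<bullet> (g p - c n))"
          unfolding k_def p_def
        proof (rule gains_lift_strategy[OF n Dn[OF n] _ _ s])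
          fix q assume q: "q \<in> \<Omega>\<^sub>G n"
          show "x \<le> gains T H q + (\<Phi> (\<tau> q) q + h \<bullet> (g q - c n))"
            using subhedgesD[OF sub q] by simp
          have q': "q \<in> \<Omega>" "\<tau> q \<le> T"
            using q grid_paths_subset stops_le[OF \<tau> q] by blast+
          have "norm h * (G + 1) \<le> B * (G + 1)"
            using h G by (intro mult_right_mono) auto
          then show "\<Phi> (\<tau> q) q + h \<bullet> (g q - c n) \<le> M + B * (G + 1)"
            using M(2)[OF q'(2,1)] net[OF q'(1), of h] by linarith
        qed
        moreover have "t * (M + B * (G + 1) - x) \<le> t * M'"
          using x t by (intro mult_left_mono) (auto simp: M'_def)
        \<comment> \<open>Both payoffs are taken at the same time \<open>\<tau> p\<close>. Summing
          over all times avoids dependence on which time that is.\<close>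
        moreover have "\<Phi> (\<tau> p) p \<le> \<Phi> (\<tau> p) s + (\<Sum>i\<le>T. osc n (\<Phi> i))"
        proof -
          have \<tau>p: "\<tau> p \<le> T"
            using stops_le[OF \<tau>' s] by (simp add: p_def)
          then have "norm (\<Phi> (\<tau> p) s - \<Phi> (\<tau> p) p) \<le> osc n (\<Phi> (\<tau> p))"
            unfolding p_def by (intro norm_diff_snap_le_osc[OF \<Phi>_cont n s]) auto
          with err(4)[OF \<tau>p] show ?thesis by simp
        qed
        moreover have "h \<bullet> (g p - c n) \<le> h \<bullet> g s + B * (osc n g + norm (c n))"
          using snap_g[OF s, of h] h osc_g mult_right_mono[OF h, of "osc n g + norm (c n)"]
          by (simp add: p_def)
        ultimately show ?thesis
          using total by (simp add: t_def p_def)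
      qed
      then have "subhedges T (prices a b) g \<Phi> (lift_strategy n H) ?\<tau> h (x - K * error (c n) n)"
        unfolding subhedges_def by blast
      with \<tau>' show ?thesis unfolding P_def by blast
    qed
    have "0 \<le> K * error (c n) n"
      using err0 B k M' by (simp add: K_def)
    then have "\<bar>Sup (P' n) - Sup P\<bar> \<le> K * error (c n) n"
      using M_in' P'_le M_in P_le lift restrict by (intro real_Sup_close[where m = "- M" and M = M]) auto
    moreover have "sub_hedging_price T (grid_prices a b n) (\<lambda>s. g s - c n) \<Phi> = ereal (Sup (P' n))"
      unfolding sub_hedging_price_eq
      using ereal_Sup_bounded[OF M_in' P'_le] unfolding P'_def .
    ultimately show ?case by blast
  qed
  moreover have "sub_hedging_price T (prices a b) g \<Phi> = ereal (Sup P)"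
    unfolding sub_hedging_price_eq
    using ereal_Sup_bounded[OF M_in P_le] unfolding P_def .
  ultimately show thesis
    by (rule that[rotated])
qed

end

section \<open>Convergence of the sub-hedging prices and its rate\<close>

theorem theorem4p2:
  fixes T :: nat
    and a b :: "nat \<Rightarrow> real"
    and g :: "path \<Rightarrow> real ^ 'e"
    and \<Phi> :: "nat \<Rightarrow> path \<Rightarrow> real"
    and c :: "nat \<Rightarrow> real ^ 'e"
  assumes "\<forall>i\<in>{1..T}. 0 \<le> a i \<and> a i < 1 \<and> 1 < b i"
    and "\<forall>i\<in>{1..<T}. a (i + 1) < a i \<and> b i < b (i + 1)"
    and "\<forall>i\<in>{1..T}. a i \<in> dyadics \<and> b i \<in> dyadics"
    and "adapted T (prices a b) \<Phi>"
    and "continuous_on (paths T (prices a b)) g"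
    and "\<forall>t\<in>{0..T}. continuous_on (paths T (prices a b)) (\<Phi> t)"
    and "\<forall>H\<in>strategies T (prices a b). \<forall>h. h \<noteq> 0 \<longrightarrow>
           (\<exists>s\<in>paths T (prices a b). gains T H s + h \<bullet> g s < 0)"
    and "(\<lambda>n. infnorm (c n)) \<longlonglongrightarrow> 0"
  shows "((\<lambda>n. sub_hedging_price T (grid_prices a b n) (\<lambda>s. g s - c n) \<Phi>)
            \<longlonglongrightarrow> sub_hedging_price T (prices a b) g \<Phi>)
       \<and> (lipschitz_paths T (prices a b) g
          \<and> (\<forall>t\<in>{0..T}. lipschitz_paths T (prices a b) (\<Phi> t))
          \<and> (\<lambda>n. infnorm (c n)) \<in> O(\<lambda>n. 1 / 2 ^ n)
          \<longrightarrow> (\<exists>C::real. \<forall>\<^sub>F n in sequentially.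
                \<bar>sub_hedging_price T (grid_prices a b n) (\<lambda>s. g s - c n) \<Phi>
                  - sub_hedging_price T (prices a b) g \<Phi>\<bar> \<le> ereal (C * (1 / 2 ^ n))))"
proof -
  interpret american_market T a b g \<Phi>
    using assms by unfold_locales auto
  let ?\<pi>' = "\<lambda>n. sub_hedging_price T (grid_prices a b n) (\<lambda>s. g s - c n) \<Phi>"
  \<comment> \<open>The assumptions on c use the sup norm, while the estimates of inner products use
    the Euclidean one.\<close>
  let ?d = "sqrt DIM(real ^ 'e)"
  have d: "norm (c n) \<le> ?d * infnorm (c n)" for n
    by (rule norm_le_infnorm)
  have "(\<lambda>n. ?d * infnorm (c n)) \<longlonglongrightarrow> 0"
    using assms(8) by (rule tendsto_mult_right_zero)
  then have "c \<longlonglongrightarrow> 0"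
    by (rule Lim_null_comparison[OF always_eventually, rotated]) (use d in blast)
  then have c: "(\<lambda>n. norm (c n)) \<longlonglongrightarrow> 0"
    by (rule tendsto_norm_zero)
  obtain r K where r: "sub_hedging_price T (prices a b) g \<Phi> = ereal r"
    and ev: "\<forall>\<^sub>F n in sequentially. \<exists>r'. ?\<pi>' n = ereal r' \<and> \<bar>r' - r\<bar> \<le> K * error (c n) n"
    using price_comparison[OF c] by blast
  \<comment> \<open>A real-valued version of the prices, which are finite for large n, so that the
    limit can be taken in the reals.\<close>
  define \<rho> where "\<rho> = (\<lambda>n. real_of_ereal (?\<pi>' n))"
  have \<rho>: "\<forall>\<^sub>F n in sequentially. ?\<pi>' n = ereal (\<rho> n) \<and> \<bar>\<rho> n - r\<bar> \<le> K * error (c n) n"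
    using ev by eventually_elim (auto simp: \<rho>_def)
  have "(\<lambda>n. K * error (c n) n) \<longlonglongrightarrow> K * 0"
    by (intro tendsto_intros error_tendsto_0 c)
  then have lim0: "(\<lambda>n. K * error (c n) n) \<longlonglongrightarrow> 0"
    by simp
  have "(\<lambda>n. \<rho> n - r) \<longlonglongrightarrow> 0"
    by (rule Lim_null_comparison[OF _ lim0]) (use \<rho> in eventually_elim, simp)
  then have "(\<lambda>n. ereal (\<rho> n)) \<longlonglongrightarrow> ereal r"
    by (simp add: LIM_zero_iff)
  moreover have "\<forall>\<^sub>F n in sequentially. ?\<pi>' n = ereal (\<rho> n)"
    using \<rho> by eventually_elim simp
  ultimately have lim: "?\<pi>' \<longlonglongrightarrow> sub_hedging_price T (prices a b) g \<Phi>"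
    unfolding r by (simp add: tendsto_cong)
  have rate: "\<exists>C::real. \<forall>\<^sub>F n in sequentially.
      \<bar>?\<pi>' n - sub_hedging_price T (prices a b) g \<Phi>\<bar> \<le> ereal (C * (1 / 2 ^ n))"
    if lip: "lipschitz_paths T (prices a b) g"
      "\<forall>t\<in>{0..T}. lipschitz_paths T (prices a b) (\<Phi> t)"
      and O: "(\<lambda>n. infnorm (c n)) \<in> O(\<lambda>n. 1 / 2 ^ n)"
  proof -
    obtain B where "\<forall>\<^sub>F n in sequentially. norm (infnorm (c n)) \<le> B * norm (1 / 2 ^ n :: real)"
      using O by (auto elim: landau_o.bigE)
    then have "\<forall>\<^sub>F n in sequentially. norm (c n) \<le> (?d * B) * (1 / 2 ^ n)"
    proof eventually_elim
      case (elim n)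
      have "norm (c n) \<le> ?d * infnorm (c n)"
        by (rule d)
      also have "\<dots> \<le> ?d * (B * (1 / 2 ^ n))"
        using elim by (intro mult_left_mono) auto
      finally show ?case by (simp only: mult.assoc)
    qed
    then obtain C where C: "\<forall>\<^sub>F n in sequentially. error (c n) n \<le> C * (1 / 2 ^ n)"
      using error_lipschitz[OF lip] by blast
    have "\<forall>\<^sub>F n in sequentially.
        \<bar>?\<pi>' n - sub_hedging_price T (prices a b) g \<Phi>\<bar> \<le> ereal (\<bar>K\<bar> * C * (1 / 2 ^ n))"
      using \<rho> C eventually_ends_in_grid
    proof eventually_elim
      case (elim n)
      \<comment> \<open>The sign of K is not recorded in \<open>price_comparison\<close>; with a
        nonnegative error, K may be replaced by its absolute value.\<close>
      have "0 \<le> error (c n) n"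
        unfolding error_def using elim(3) g_cont \<Phi>_cont
        by (intro add_nonneg_nonneg sum_nonneg osc_nonneg) auto
      then have "K * error (c n) n \<le> \<bar>K\<bar> * (C * (1 / 2 ^ n))"
        using elim(2) by (intro mult_mono) auto
      with elim(1) show ?case
        by (simp add: r)
    qed
    then show ?thesis by blast
  qed
  from lim rate show ?thesis by blast
qed

end
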